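(* Let $\{(\lambda_i,\nu_i)\}_{i>0}$ be the eigenpairs of $-\Delta_{W,V}$ with $\lambda_i>0$, i.e. $0\ne\nu_i\in\mathcal{D}_{W,V}(\mathbb{T})$ and $-\Delta_{W,V}\nu_i=\lambda_i\nu_i$. Then there exist $a_i,b_i\in\mathbb{R}$ such that $$\nu_{i}(x)=a_{i}C_{W,V}\left(\sqrt{\lambda_{i}},x\right)+\frac{b_{i}}{\sqrt{\lambda_{i}}}S_{W,V}\left(\sqrt{\lambda_{i}},x\right)\quad V\text{-a.e.}$$ Furthermore, for each $i$, the vector $(a_i,b_i)\neq(0,0)$ is obtained as a solution of the system $$\begin{cases} a_{i}\left[C_{W,V}\left(\sqrt{\lambda_{i}},1\right)-1\right]+\dfrac{b_{i}}{\sqrt{\lambda_{i}}}S_{W,V}(\sqrt{\lambda_{i}},1)=0,\\[1ex] \dfrac{a_{i}}{\sqrt{\lambda_{i}}}S_{V,W}(\sqrt{\lambda_{i}},1)-\dfrac{b_{i}}{\lambda_{i}}\left[C_{V,W}\left(\sqrt{\lambda_{i}},1\right)-1\right]=0.\end{cases}$$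
   Context: $W,V:\mathbb{R}\to\mathbb{R}$ are strictly increasing, $W$ càdlàg, $V$ càglàd, $W(x+1)-W(x)=W(1)-W(0)$ and $V(x+1)-V(x)=V(1)-V(0)$ for all $x$, both are continuous at $0$ and $W(0)=V(0)=0$. $\mathbb{T}=\mathbb{R}/\mathbb{Z}$, identified with $[0,1)$. The measures $dW,dV$ are given by $dW((a,b])=W(b)-W(a)$, $dV([a,b))=V(b)-V(a)$. $L^2_V(\mathbb{T})$ is the $L^2$ space of $dV$ and $L^2_{V,0}(\mathbb{T})=\{f\in L^2_V(\mathbb{T}):\int_{\mathbb{T}}f\,dV=0\}$. $\mathcal{D}_{W,V}(\mathbb{T})$ is the set of $f\in L^2_V(\mathbb{T})$ for which there are $a,b\in\mathbb{R}$ and $\mathfrak{f}\in L^2_{V,0}(\mathbb{T})$ with $f(x)=a+bW(x)+\int_{(0,x]}\int_{[0,y)}\mathfrak{f}(s)\,dV(s)\,dW(y)$ and $bW(1)+\int_{(0,1]}\int_{[0,y)}\mathfrak{f}(s)\,dV(s)\,dW(y)=0$; then $\Delta_{W,V}f:=\mathfrak{f}$. For $0\le s\le x$: $F_1(x,s)=W(s)$, $G_1(x,s)=V(s)$, and for $n\ge2$ $$F_{n}(x,s)=\int_{[0,s)}[F_{n-1}(x,x)-F_{n-1}(x,\xi)]\,dV(\xi)\ (n\text{ even}),\quad F_{n}(x,s)=\int_{(0,s]}[F_{n-1}(x,x)-F_{n-1}(x,\xi)]\,dW(\xi)\ (n\text{ odd}),$$ $$G_{n}(x,s)=\int_{(0,s]}[G_{n-1}(x,x)-G_{n-1}(x,\xi)]\,dW(\xi)\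 (n\text{ even}),\quad G_{n}(x,s)=\int_{[0,s)}[G_{n-1}(x,x)-G_{n-1}(x,\xi)]\,dV(\xi)\ (n\text{ odd}),$$ and $F_0(x,x)=G_0(x,x)=1$. The generalized trigonometric functions are $$C_{W,V}(\alpha,x)=\sum_{n\ge0}(-1)^n\alpha^{2n}F_{2n}(x,x),\quad S_{W,V}(\alpha,x)=\sum_{n\ge0}(-1)^n\alpha^{2n+1}F_{2n+1}(x,x),$$ $$C_{V,W}(\alpha,x)=\sum_{n\ge0}(-1)^n\alpha^{2n}G_{2n}(x,x),\quad S_{V,W}(\alpha,x)=\sum_{n\ge0}(-1)^n\alpha^{2n+1}G_{2n+1}(x,x).$$ *)

theory Defs
  imports "HOL-Analysis.Analysis"
begin

definition cadlag :: "(real \<Rightarrow> real) \<Rightarrow> bool" where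
  "cadlag f \<longleftrightarrow> (\<forall>x. continuous (at_right x) f \<and> (\<exists>l. (f \<longlongrightarrow> l) (at_left x)))"

definition caglad :: "(real \<Rightarrow> real) \<Rightarrow> bool" where
  "caglad f \<longleftrightarrow> (\<forall>x. continuous (at_left x) f \<and> (\<exists>l. (f \<longlongrightarrow> l) (at_right x)))"

text \<open>The library's \<open>interval_measure W\<close> is the measure \<open>dW\<close> with \<open>dW (a,b] = W b - W a\<close> for
  right-continuous \<open>W\<close>. For left-continuous \<open>V\<close>, the measure \<open>dV\<close> with \<open>dV [a,b) = V b - V a\<close> is
  obtained from it by reflection, since \<open>x \<mapsto> - V (- x)\<close> is right-continuous; see the lemma
  \<open>emeasure_left_interval_measure\<close> below.\<close>

definition left_interval_measure :: "(real \<Rightarrow> real) \<Rightarrow> real measure" where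
  "left_interval_measure V = distr (interval_measure (\<lambda>x. - V (- x))) borel uminus"

lemma emeasure_left_interval_measure:
  assumes "a \<le> b" "mono V" "caglad V"
  shows "emeasure (left_interval_measure V) {a..<b} = ennreal (V b - V a)"
proof -
  let ?F = "\<lambda>x. - V (- x)"
  have mono: "\<And>x y. x \<le> y \<Longrightarrow> ?F x \<le> ?F y"
    using assms(2) by (simp add: monoD)
  have cont: "continuous (at_right x) ?F" for x
  proof -
    have "(V \<longlongrightarrow> V (- x)) (at_left (- x))"
      using assms(3) by (simp add: caglad_def continuous_within)
    moreover have "filterlim uminus (at_left (- x)) (at_right x)"
      by (simp add: at_right_minus[of x] filterlim_def filtermap_filtermap)
    ultimately have "((\<lambda>y. V (- y)) \<longlongrightarrow> V (- x)) (at_right x)"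
      by (rule filterlim_compose)
    then show ?thesis
      by (simp add: continuous_within tendsto_minus)
  qed
  have "uminus -` {a..<b} = {- b<..- a}"
    by auto
  then have "emeasure (left_interval_measure V) {a..<b} = emeasure (interval_measure ?F) {- b<..- a}"
    unfolding left_interval_measure_def by (subst emeasure_distr) auto
  also have "\<dots> = ennreal (V b - V a)"
    using emeasure_interval_measure_Ioc[of "- b" "- a" ?F] mono cont assms(1) by simp
  finally show ?thesis .
qed

text \<open>The torus is identified with \<open>[0,1)\<close>; functions on it are represented by functions on the reals
  whose values outside \<open>[0,1)\<close> are irrelevant.\<close>

definition torus_measure :: "(real \<Rightarrow> real) \<Rightarrow> real measure" where
  "torus_measure V = restrict_space (left_interval_measure V) {0..<1}"

text \<open>Elements of the \<open>L\<^sup>2\<close> spaces are represented by functions, so equality of elements is equality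
  almost everywhere.\<close>

definition L2 :: "(real \<Rightarrow> real) \<Rightarrow> (real \<Rightarrow> real) set" where
  "L2 V = {f \<in> borel_measurable (torus_measure V). integrable (torus_measure V) (\<lambda>x. (f x)\<^sup>2)}"

definition L2_zero_mean :: "(real \<Rightarrow> real) \<Rightarrow> (real \<Rightarrow> real) set" where
  "L2_zero_mean V = {f \<in> L2 V. (LINT x|torus_measure V. f x) = 0}"

definition double_integral :: "(real \<Rightarrow> real) \<Rightarrow> (real \<Rightarrow> real) \<Rightarrow> (real \<Rightarrow> real) \<Rightarrow> real \<Rightarrow> real" where
  "double_integral W V g x =
     (LINT y:{0<..x}|interval_measure W. (LINT s:{0..<y}|left_interval_measure V. g s))"

definition laplacian_witness ::
    "(real \<Rightarrow> real) \<Rightarrow> (real \<Rightarrow> real) \<Rightarrow> (real \<Rightarrow> real) \<Rightarrow> (real \<Rightarrow> real) \<Rightarrow> bool" where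
  "laplacian_witness W V f g \<longleftrightarrow>
     g \<in> L2_zero_mean V \<and>
     (\<exists>a b. (AE x in torus_measure V. f x = a + b * W x + double_integral W V g x) \<and>
            b * W 1 + double_integral W V g 1 = 0)"

definition laplacian_domain :: "(real \<Rightarrow> real) \<Rightarrow> (real \<Rightarrow> real) \<Rightarrow> (real \<Rightarrow> real) set" where
  "laplacian_domain W V = {f \<in> L2 V. \<exists>g. laplacian_witness W V f g}"

text \<open>For \<open>f\<close> in the domain the witness is unique up to a null set, so the choice below only picks a
  representative of an element of \<open>L\<^sup>2\<close>.\<close>

definition laplacian :: "(real \<Rightarrow> real) \<Rightarrow> (real \<Rightarrow> real) \<Rightarrow> (real \<Rightarrow> real) \<Rightarrow> real \<Rightarrow> real" where
  "laplacian W V f = (SOME g. laplacian_witness W V f g)"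

definition neg_laplacian_eigenpair ::
    "(real \<Rightarrow> real) \<Rightarrow> (real \<Rightarrow> real) \<Rightarrow> real \<Rightarrow> (real \<Rightarrow> real) \<Rightarrow> bool" where
  "neg_laplacian_eigenpair W V l f \<longleftrightarrow>
     f \<in> laplacian_domain W V \<and>
     \<not> (AE x in torus_measure V. f x = 0) \<and>
     (AE x in torus_measure V. - laplacian W V f x = l * f x)"

text \<open>Only the diagonal values \<open>x = s\<close> are used for index \<open>0\<close>, and only \<open>0 \<le> s \<le> x\<close> is relevant.\<close>

fun F_WV :: "(real \<Rightarrow> real) \<Rightarrow> (real \<Rightarrow> real) \<Rightarrow> nat \<Rightarrow> real \<Rightarrow> real \<Rightarrow> real" where
  "F_WV W V 0 x s = 1"
| "F_WV W V (Suc 0) x s = W s"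
| "F_WV W V (Suc (Suc n)) x s =
     (if even (Suc (Suc n))
      then LINT \<xi>:{0..<s}|left_interval_measure V. F_WV W V (Suc n) x x - F_WV W V (Suc n) x \<xi>
      else LINT \<xi>:{0<..s}|interval_measure W. F_WV W V (Suc n) x x - F_WV W V (Suc n) x \<xi>)"

fun G_WV :: "(real \<Rightarrow> real) \<Rightarrow> (real \<Rightarrow> real) \<Rightarrow> nat \<Rightarrow> real \<Rightarrow> real \<Rightarrow> real" where
  "G_WV W V 0 x s = 1"
| "G_WV W V (Suc 0) x s = V s"
| "G_WV W V (Suc (Suc n)) x s =
     (if even (Suc (Suc n))
      then LINT \<xi>:{0<..s}|interval_measure W. G_WV W V (Suc n) x x - G_WV W V (Suc n) x \<xi>
      else LINT \<xi>:{0..<s}|left_interval_measure V. G_WV W V (Suc n) x x - G_WV W V (Suc n) x \<xi>)"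

text \<open>In all four functions the first argument is the right-continuous \<open>W\<close> and the second the
  left-continuous \<open>V\<close>; the suffix of the name gives the order in the mathematical notation.\<close>

definition C_WV :: "(real \<Rightarrow> real) \<Rightarrow> (real \<Rightarrow> real) \<Rightarrow> real \<Rightarrow> real \<Rightarrow> real" where
  "C_WV W V \<alpha> x = (\<Sum>n. (-1) ^ n * \<alpha> ^ (2 * n) * F_WV W V (2 * n) x x)"

definition S_WV :: "(real \<Rightarrow> real) \<Rightarrow> (real \<Rightarrow> real) \<Rightarrow> real \<Rightarrow> real \<Rightarrow> real" where
  "S_WV W V \<alpha> x = (\<Sum>n. (-1) ^ n * \<alpha> ^ (2 * n + 1) * F_WV W V (2 * n + 1) x x)"

definition C_VW :: "(real \<Rightarrow> real) \<Rightarrow> (real \<Rightarrow> real) \<Rightarrow> real \<Rightarrow> real \<Rightarrow> real" where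
  "C_VW W V \<alpha> x = (\<Sum>n. (-1) ^ n * \<alpha> ^ (2 * n) * G_WV W V (2 * n) x x)"

definition S_VW :: "(real \<Rightarrow> real) \<Rightarrow> (real \<Rightarrow> real) \<Rightarrow> real \<Rightarrow> real \<Rightarrow> real" where
  "S_VW W V \<alpha> x = (\<Sum>n. (-1) ^ n * \<alpha> ^ (2 * n + 1) * G_WV W V (2 * n + 1) x x)"

end

theory Submission
  imports Defs
begin

text \<open>
  Put \<open>(I h) x = \<integral>\<^bsub>(0,x]\<^esub> h dW\<close> and \<open>(J h) x = \<integral>\<^bsub>[0,x)\<^esub> h dV\<close>. An eigenfunction is almost everywhere
  equal to a locally bounded function \<open>w\<close> which satisfies on \<open>[0,1]\<close> the Volterra equation
  \<open>w = a + b W - \<lambda> I (J w)\<close>. Iterating the equation gives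
  \<open>w = \<Sum>\<^sub>n (-\<lambda>)\<^sup>n (I J)\<^sup>n (a + b W)\<close>, and the whole proof consists in seeing that this series is the
  one which defines the generalized trigonometric functions and that it converges.

  For the first point, Fubini's theorem on \<open>{(s, t). s < t}\<close> shows that
  \<open>h \<mapsto> I h x - I h \<cdot>\<close>, which builds the functions \<open>F\<^sub>n\<close> and \<open>G\<^sub>n\<close> from the largest variable
  downwards, is adjoint to \<open>J\<close>, which builds the iterates of \<open>I J\<close> from the smallest variable upwards
  (\<open>primitive_adjoint\<close>). Hence \<open>F\<^bsub>2n\<^esub>(x,x) = (I J)\<^sup>n 1\<close> and \<open>F\<^bsub>2n+1\<^esub>(x,x) = (I J)\<^sup>n W\<close>, and for \<open>G\<^sub>n\<close> the same
  holds with the two measures interchanged.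

  For the second point, \<open>(I J)\<^sup>n 1\<close> is at most \<open>V(x)\<^sup>n W(x)\<^sup>n / n!\<close>. Both measures may have atoms, where
  the chain rule for \<open>W\<^sup>n\<close> fails; the adjointness reduces the estimate to the elementary inequality
  \<open>(X - y) y\<^sup>n \<le> X\<^bsup>n+1\<^esup>/(n+1)\<close> for \<open>0 \<le> y \<le> X\<close> (\<open>double_primitive_power_le\<close>).

  The linear system consists of the two boundary conditions. The condition in the definition of the
  domain is \<open>w 1 = a\<close>. That the Laplacian has mean zero means \<open>J w 1 = 0\<close>; as \<open>J w\<close> satisfies the dual
  Volterra equation \<open>J w = J (a + b W) - \<lambda> J (I (J w))\<close>, its value is a combination of the functions
  with \<open>V\<close> and \<open>W\<close> interchanged, so that no series has to be integrated term by term
  (\<open>volterra_solution\<close>).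
\<close>

section \<open>Locally bounded functions\<close>

definition admissible :: "(real \<Rightarrow> real) \<Rightarrow> bool" where
  "admissible f \<longleftrightarrow> f \<in> borel_measurable borel \<and> (\<forall>x. \<exists>K. \<forall>y\<in>{0..x}. \<bar>f y\<bar> \<le> K)"

lemma admissibleD_measurable: "admissible f \<Longrightarrow> f \<in> borel_measurable borel"
  by (simp add: admissible_def)

lemma admissibleD_bounded:
  assumes "admissible f"
  obtains K where "K \<ge> 0" "\<And>y. 0 \<le> y \<Longrightarrow> y \<le> x \<Longrightarrow> \<bar>f y\<bar> \<le> K"
proof -
  obtain K where "\<forall>y\<in>{0..x}. \<bar>f y\<bar> \<le> K"
    using assms unfolding admissible_def by blast
  then show ?thesis
    by (intro that[of "max K 0"]) (auto simp: le_max_iff_disj)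
qed

lemma admissible_const [simp]: "admissible (\<lambda>x. c)"
  unfolding admissible_def by auto

lemma admissible_add:
  assumes "admissible f" "admissible g"
  shows "admissible (\<lambda>x. f x + g x)"
  unfolding admissible_def
proof (intro conjI allI)
  show "(\<lambda>x. f x + g x) \<in> borel_measurable borel"
    using assms by (auto simp: admissible_def)
  fix x
  obtain K where K: "\<And>y. 0 \<le> y \<Longrightarrow> y \<le> x \<Longrightarrow> \<bar>f y\<bar> \<le> K"
    using admissibleD_bounded[OF assms(1)] by metis
  obtain L where L: "\<And>y. 0 \<le> y \<Longrightarrow> y \<le> x \<Longrightarrow> \<bar>g y\<bar> \<le> L"
    using admissibleD_bounded[OF assms(2)] by metis
  show "\<exists>K. \<forall>y\<in>{0..x}. \<bar>f y + g y\<bar> \<le> K"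
    by (rule exI[of _ "K + L"]) (auto intro!: order_trans[OF abs_triangle_ineq] add_mono K L)
qed

lemma admissible_mult:
  assumes "admissible f" "admissible g"
  shows "admissible (\<lambda>x. f x * g x)"
  unfolding admissible_def
proof (intro conjI allI)
  show "(\<lambda>x. f x * g x) \<in> borel_measurable borel"
    using assms by (auto simp: admissible_def)
  fix x
  obtain K where K: "K \<ge> 0" "\<And>y. 0 \<le> y \<Longrightarrow> y \<le> x \<Longrightarrow> \<bar>f y\<bar> \<le> K"
    using admissibleD_bounded[OF assms(1)] by metis
  obtain L where L: "L \<ge> 0" "\<And>y. 0 \<le> y \<Longrightarrow> y \<le> x \<Longrightarrow> \<bar>g y\<bar> \<le> L"
    using admissibleD_bounded[OF assms(2)] by metis
  show "\<exists>K. \<forall>y\<in>{0..x}. \<bar>f y * g y\<bar> \<le> K"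
    by (rule exI[of _ "K * L"]) (auto simp: abs_mult intro!: mult_mono K L)
qed

lemma admissible_diff:
  assumes "admissible f" "admissible g"
  shows "admissible (\<lambda>x. f x - g x)"
  using admissible_add[OF assms(1) admissible_mult[OF admissible_const[of "-1"] assms(2)]] by simp

lemma admissible_power:
  assumes "admissible f"
  shows "admissible (\<lambda>x. f x ^ n)"
  by (induction n) (auto intro: admissible_mult assms)

lemmas admissible_intros = admissible_const admissible_add admissible_mult admissible_diff
  admissible_power

section \<open>Integration over initial segments\<close>

text \<open>The segments \<open>(0,x]\<close> for \<open>dW\<close> and \<open>[0,x)\<close> for \<open>dV\<close> are treated by one axiomatisation, so that
  every result about the pair \<open>(W, V)\<close> can also be read for \<open>(V, W)\<close>.\<close>

locale initial_segments = sigma_finite_measure M for M :: "real measure" +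
  fixes A :: "real \<Rightarrow> real set"
  assumes sets_M [measurable_cong, simp]: "sets M = sets borel"
    and segment_pairs: "{(x, y). y \<in> A x} \<in> sets (borel \<Otimes>\<^sub>M borel)"
    and segment_subset: "A x \<subseteq> {0..x}"
    and segment_mono: "s \<le> x \<Longrightarrow> A s \<subseteq> A x"
    and segment_finite: "emeasure M (A x) < \<infinity>"
begin

lemma space_M [simp]: "space M = UNIV"
  using sets_eq_imp_space_eq[OF sets_M] by simp

lemma segment_measurable [measurable]: "A x \<in> sets borel"
proof -
  have "Pair x -` {(x, y). y \<in> A x} \<in> sets borel"
    by (rule sets_Pair1[OF segment_pairs])
  then show ?thesis by (simp add: vimage_def)
qed

definition primitive :: "(real \<Rightarrow> real) \<Rightarrow> real \<Rightarrow> real" where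
  "primitive h x = (LINT y:A x|M. h y)"

lemma primitive_measurable:
  assumes [measurable]: "h \<in> borel_measurable borel"
  shows "primitive h \<in> borel_measurable borel"
proof -
  have "(\<lambda>z. indicator {(x, y). y \<in> A x} z * h (snd z)) \<in> borel_measurable (borel \<Otimes>\<^sub>M borel)"
    using segment_pairs by measurable
  moreover have "sets (borel \<Otimes>\<^sub>M M) = sets (borel \<Otimes>\<^sub>M borel)"
    by (intro sets_pair_measure_cong) auto
  ultimately have "(\<lambda>z. indicator {(x, y). y \<in> A x} z * h (snd z)) \<in> borel_measurable (borel \<Otimes>\<^sub>M M)"
    using measurable_cong_sets by blast
  then have "(\<lambda>(x, y). indicator (A x) y *\<^sub>R h y) \<in> borel_measurable (borel \<Otimes>\<^sub>M M)"
    by (rule back_subst[of "\<lambda>f. f \<in> _"]) (auto simp: fun_eq_iff indicator_def)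
  then show ?thesis
    unfolding primitive_def set_lebesgue_integral_def
    by (rule borel_measurable_lebesgue_integral)
qed

lemma primitive_cong:
  assumes "\<And>y. 0 \<le> y \<Longrightarrow> y \<le> x \<Longrightarrow> f y = g y"
  shows "primitive f x = primitive g x"
  unfolding primitive_def
  by (rule set_lebesgue_integral_cong) (use segment_subset[of x] assms in \<open>auto simp: subset_iff\<close>)

lemma admissible_set_integrable:
  assumes "admissible f"
  shows "set_integrable M (A x) f"
proof -
  have [measurable]: "f \<in> borel_measurable borel" by (rule admissibleD_measurable[OF assms])
  obtain K where K: "\<And>y. 0 \<le> y \<Longrightarrow> y \<le> x \<Longrightarrow> \<bar>f y\<bar> \<le> K"
    using admissibleD_bounded[OF assms] by metis
  show ?thesis
    unfolding set_integrable_def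
    by (rule integrableI_bounded_set_indicator[where B = K])
      (use K segment_subset[of x] segment_finite[of x] in \<open>auto simp: subset_iff\<close>)
qed

lemma primitive_mono_segment:
  assumes "s \<le> x" "\<And>x. set_integrable M (A x) h" "\<And>y. 0 \<le> h y"
  shows "primitive h s \<le> primitive h x"
  unfolding primitive_def set_lebesgue_integral_def
  by (rule integral_mono)
    (use assms segment_mono[OF assms(1)] in \<open>auto simp: set_integrable_def indicator_def\<close>)

text \<open>Integrability, rather than boundedness, is assumed because the Laplacian of an eigenfunction is
  at first only square integrable.\<close>

lemma admissible_primitive_integrable:
  assumes "h \<in> borel_measurable borel" and int: "\<And>x. set_integrable M (A x) h"
  shows "admissible (primitive h)"
  unfolding admissible_def
proof (intro conjI allI)
  show "primitive h \<in> borel_measurable borel"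
    using assms(1) by (rule primitive_measurable)
  fix x
  show "\<exists>K. \<forall>y\<in>{0..x}. \<bar>primitive h y\<bar> \<le> K"
  proof (intro exI ballI)
    fix y assume y: "y \<in> {0..x}"
    have "\<bar>primitive h y\<bar> \<le> (LINT s:A y|M. \<bar>h s\<bar>)"
      using set_integral_norm_bound[OF int[of y]] by (simp add: primitive_def)
    also have "\<dots> \<le> (LINT s:A x|M. \<bar>h s\<bar>)"
      using primitive_mono_segment[of y x "\<lambda>s. \<bar>h s\<bar>"] y set_integrable_abs[OF int]
      by (simp add: primitive_def)
    finally show "\<bar>primitive h y\<bar> \<le> (LINT s:A x|M. \<bar>h s\<bar>)" .
  qed
qed

lemma admissible_primitive: "admissible f \<Longrightarrow> admissible (primitive f)"
  by (rule admissible_primitive_integrable[OF admissibleD_measurable admissible_set_integrable])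

lemma primitive_linear:
  assumes "admissible f" "admissible g"
  shows "primitive (\<lambda>y. c * f y + d * g y) x = c * primitive f x + d * primitive g x"
  using assms unfolding primitive_def
  by (simp add: set_integral_add(2) admissible_set_integrable admissible_mult)

lemma primitive_abs_le:
  assumes "admissible f" "admissible g" "\<And>y. 0 \<le> y \<Longrightarrow> y \<le> x \<Longrightarrow> \<bar>f y\<bar> \<le> g y"
  shows "\<bar>primitive f x\<bar> \<le> primitive g x"
proof -
  have "\<bar>primitive f x\<bar> \<le> (LINT s:A x|M. \<bar>f s\<bar>)"
    using set_integral_norm_bound[OF admissible_set_integrable[OF assms(1)]]
    by (simp add: primitive_def)
  also have "\<dots> \<le> primitive g x"
    unfolding primitive_def
    by (rule set_integral_mono)
      (use segment_subset[of x] assms in \<open>auto simp: subset_iff intro: set_integrable_abs[OF admissible_set_integrable] admissible_set_integrable\<close>)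
  finally show ?thesis .
qed

lemma primitive_one_mono:
  assumes "s \<le> x"
  shows "primitive (\<lambda>_. 1) s \<le> primitive (\<lambda>_. 1) x"
  by (rule primitive_mono_segment[OF assms]) (simp_all add: admissible_set_integrable)

lemma primitive_one_nonneg: "0 \<le> primitive (\<lambda>_. 1) x"
  using primitive_abs_le[of "\<lambda>_. 1" "\<lambda>_. 1" x] by simp

end

section \<open>Interlaced pairs of measures and adjointness\<close>

text \<open>The last assumption says that \<open>A\<close> and \<open>B\<close> resolve ties in a complementary way: when an \<open>M\<close>-variable
  meets an \<open>N\<close>-variable, exactly one of the two counts as the earlier one. For \<open>(0,x]\<close> and \<open>[0,x)\<close>
  the point of \<open>dW\<close> precedes the point of \<open>dV\<close> at the same place, since \<open>s \<in> (0,t]\<close> iff not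
  \<open>t \<in> [0,s)\<close>. The condition is invariant under exchanging the roles of the two measures.\<close>

locale interlaced_measures = M: initial_segments M A + N: initial_segments N B
  for M N :: "real measure" and A B :: "real \<Rightarrow> real set" +
  assumes interlaced: "s \<in> A x \<Longrightarrow> t \<in> B x \<Longrightarrow> t \<in> B s \<longleftrightarrow> s \<notin> A t"
begin

lemma interlaced_measures_swap: "interlaced_measures N M B A"
  by unfold_locales (use interlaced in blast)

text \<open>Both sides integrate \<open>p t * h s\<close> over the pairs in \<open>B x \<times> A x\<close> in which \<open>t\<close> comes before \<open>s\<close>: such
  pairs are described by \<open>s \<notin> A t\<close> when \<open>s\<close> is integrated first, and by \<open>t \<in> B s\<close> when \<open>t\<close> is. The
  statement is a form of integration by parts which is correct in the presence of common atoms.\<close>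

lemma primitive_adjoint:
  assumes "admissible p" "admissible h"
  shows "N.primitive (\<lambda>t. p t * (M.primitive h x - M.primitive h t)) x =
    M.primitive (\<lambda>s. N.primitive p s * h s) x"
proof -
  interpret pair_sigma_finite N M ..
  have [measurable]: "p \<in> borel_measurable borel" "h \<in> borel_measurable borel"
    using assms admissibleD_measurable by auto
  let ?k = "\<lambda>t s. indicator (B x) t * indicator (A x) s * indicator (B s) t * (p t * h s) :: real"
  obtain K where K: "K \<ge> 0" "\<And>y. 0 \<le> y \<Longrightarrow> y \<le> x \<Longrightarrow> \<bar>p y\<bar> \<le> K"
    using admissibleD_bounded[OF assms(1)] by metis
  obtain L where L: "L \<ge> 0" "\<And>y. 0 \<le> y \<Longrightarrow> y \<le> x \<Longrightarrow> \<bar>h y\<bar> \<le> L"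
    using admissibleD_bounded[OF assms(2)] by metis
  have sets: "sets (N \<Otimes>\<^sub>M M) = sets (borel \<Otimes>\<^sub>M borel)"
    by (intro sets_pair_measure_cong) auto
  have "(\<lambda>z. (snd z, fst z)) \<in> measurable (borel \<Otimes>\<^sub>M borel) (borel \<Otimes>\<^sub>M borel)"
    by measurable
  from measurable_sets[OF this N.segment_pairs]
  have [measurable]: "{z. fst z \<in> B (snd z)} \<in> sets (borel \<Otimes>\<^sub>M borel)"
    by (simp add: vimage_def space_pair_measure case_prod_beta)
  have "(\<lambda>z. indicator (B x) (fst z) * indicator (A x) (snd z)
      * indicator {z. fst z \<in> B (snd z)} z * (p (fst z) * h (snd z)) :: real)
      \<in> borel_measurable (borel \<Otimes>\<^sub>M borel)"
    by measurable
  then have "(\<lambda>z. indicator (B x) (fst z) * indicator (A x) (snd z)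
      * indicator {z. fst z \<in> B (snd z)} z * (p (fst z) * h (snd z)) :: real)
      \<in> borel_measurable (N \<Otimes>\<^sub>M M)"
    using measurable_cong_sets[OF sets refl] by blast
  then have meas: "case_prod ?k \<in> borel_measurable (N \<Otimes>\<^sub>M M)"
    by (rule back_subst[of "\<lambda>f. f \<in> _"]) (auto simp: fun_eq_iff indicator_def)
  have int: "integrable (N \<Otimes>\<^sub>M M) (case_prod ?k)"
  proof (rule integrableI_bounded_set[where A = "B x \<times> A x" and B = "K * L"])
    show "emeasure (N \<Otimes>\<^sub>M M) (B x \<times> A x) < \<infinity>"
      using M.segment_finite[of x] N.segment_finite[of x]
      by (simp add: M.emeasure_pair_measure_Times ennreal_mult_less_top)
    show "AE z\<in>B x \<times> A x in N \<Otimes>\<^sub>M M. norm (case z of (t, s) \<Rightarrow> ?k t s) \<le> K * L"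
    proof (rule AE_I2, rule impI)
      fix z assume "z \<in> B x \<times> A x"
      then obtain t s where z: "z = (t, s)" "t \<in> B x" "s \<in> A x" by auto
      have "\<bar>p t * h s\<bar> \<le> K * L"
        unfolding abs_mult using z K L M.segment_subset[of x] N.segment_subset[of x]
        by (intro mult_mono) auto
      then show "norm (case z of (t, s) \<Rightarrow> ?k t s) \<le> K * L"
        using z K L by (auto simp: indicator_def)
    qed
  qed (use meas in \<open>auto split: prod.split simp: indicator_def\<close>)
  have "N.primitive (\<lambda>t. p t * (M.primitive h x - M.primitive h t)) x = (LINT t|N. LINT s|M. ?k t s)"
    unfolding N.primitive_def set_lebesgue_integral_def
  proof (rule Bochner_Integration.integral_cong[OF refl])
    fix t
    show "indicator (B x) t *\<^sub>R (p t * (M.primitive h x - M.primitive h t)) = (LINT s|M. ?k t s)"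
    proof (cases "t \<in> B x")
      case True
      then have sub: "A t \<subseteq> A x"
        using N.segment_subset[of x] by (intro M.segment_mono) auto
      have "M.primitive h x - M.primitive h t =
          (LINT s|M. indicator (A x) s *\<^sub>R h s - indicator (A t) s *\<^sub>R h s)"
        unfolding M.primitive_def set_lebesgue_integral_def
        using M.admissible_set_integrable[OF assms(2)]
        by (subst Bochner_Integration.integral_diff) (auto simp: set_integrable_def)
      also have "\<dots> = (LINT s|M. indicator (A x) s * indicator (B s) t * h s)"
        by (intro Bochner_Integration.integral_cong refl)
          (use sub interlaced True in \<open>auto simp: indicator_def\<close>)
      finally show ?thesis
        using True by (simp flip: integral_mult_right_zero add: mult_ac)
    qed simp
  qed
  also have "\<dots> = (LINT s|M. LINT t|N. ?k t s)"
    by (rule Fubini_integral[OF int, symmetric])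
  also have "\<dots> = M.primitive (\<lambda>s. N.primitive p s * h s) x"
    unfolding M.primitive_def set_lebesgue_integral_def
  proof (rule Bochner_Integration.integral_cong[OF refl])
    fix s
    show "(LINT t|N. ?k t s) = indicator (A x) s *\<^sub>R (N.primitive p s * h s)"
    proof (cases "s \<in> A x")
      case True
      then have "B s \<subseteq> B x"
        using M.segment_subset[of x] by (intro N.segment_mono) auto
      then have "(LINT t|N. ?k t s) = (LINT t|N. h s * (indicator (B s) t * p t))"
        by (intro Bochner_Integration.integral_cong refl) (use True in \<open>auto simp: indicator_def\<close>)
      then show ?thesis
        using True by (simp add: N.primitive_def set_lebesgue_integral_def mult.commute)
    qed simp
  qed
  finally show ?thesis .
qed

lemmas primitive_adjoint_swap =
  interlaced_measures.primitive_adjoint[OF interlaced_measures_swap]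

section \<open>Iterated double primitives\<close>

definition double_primitive :: "(real \<Rightarrow> real) \<Rightarrow> real \<Rightarrow> real" where
  "double_primitive f = M.primitive (N.primitive f)"

lemma admissible_double_primitive: "admissible f \<Longrightarrow> admissible (double_primitive f)"
  by (simp add: double_primitive_def M.admissible_primitive N.admissible_primitive)

lemma admissible_iterate: "admissible f \<Longrightarrow> admissible ((double_primitive ^^ n) f)"
  by (induction n) (auto simp: admissible_double_primitive)

lemma double_primitive_cong:
  assumes "\<And>y. 0 \<le> y \<Longrightarrow> y \<le> x \<Longrightarrow> f y = g y"
  shows "double_primitive f x = double_primitive g x"
  unfolding double_primitive_def
  by (intro M.primitive_cong N.primitive_cong) (use assms in auto)

lemma iterate_cong:
  assumes "\<And>y. 0 \<le> y \<Longrightarrow> y \<le> x \<Longrightarrow> f y = g y" "0 \<le> x"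
  shows "(double_primitive ^^ n) f x = (double_primitive ^^ n) g x"
  using assms
proof (induction n arbitrary: x)
  case (Suc n)
  then show ?case by (auto intro!: double_primitive_cong)
qed auto

lemma double_primitive_linear:
  assumes "admissible f" "admissible g"
  shows "double_primitive (\<lambda>y. c * f y + d * g y) = (\<lambda>x. c * double_primitive f x + d * double_primitive g x)"
proof -
  have "N.primitive (\<lambda>y. c * f y + d * g y) = (\<lambda>x. c * N.primitive f x + d * N.primitive g x)"
    by (intro ext N.primitive_linear assms)
  then show ?thesis
    unfolding double_primitive_def
    by (simp only:) (intro ext M.primitive_linear N.admissible_primitive assms)
qed

lemma iterate_linear:
  assumes "admissible f" "admissible g"
  shows "(double_primitive ^^ n) (\<lambda>y. c * f y + d * g y) =
    (\<lambda>x. c * (double_primitive ^^ n) f x + d * (double_primitive ^^ n) g x)"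
  by (induction n) (simp_all add: double_primitive_linear admissible_iterate assms)

lemma double_primitive_abs_le:
  assumes "admissible f" "admissible g" "\<And>y. 0 \<le> y \<Longrightarrow> y \<le> x \<Longrightarrow> \<bar>f y\<bar> \<le> g y"
  shows "\<bar>double_primitive f x\<bar> \<le> double_primitive g x"
  unfolding double_primitive_def
  by (intro M.primitive_abs_le N.primitive_abs_le M.admissible_primitive N.admissible_primitive)
    (use assms in auto)

text \<open>The chain rule for powers of \<open>m\<close> fails at the atoms of \<open>M\<close>, but moving the inner integral to the
  other side by adjointness leaves \<open>m t ^ n * (m x - m t)\<close>, which can be bounded pointwise.\<close>

lemma double_primitive_power_le:
  fixes n :: nat
  defines "m \<equiv> M.primitive (\<lambda>_. 1)"
  shows "double_primitive (\<lambda>y. m y ^ n) x \<le> N.primitive (\<lambda>_. 1) x * m x ^ Suc n / Suc n"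
proof -
  have adm: "admissible m" unfolding m_def by (intro M.admissible_primitive admissible_const)
  have m0: "0 \<le> m y" for y unfolding m_def by (rule M.primitive_one_nonneg)
  have "double_primitive (\<lambda>y. m y ^ n) x = N.primitive (\<lambda>t. m t ^ n * (m x - m t)) x"
    using primitive_adjoint[of "\<lambda>y. m y ^ n" "\<lambda>_. 1" x] adm
    by (simp add: admissible_power double_primitive_def flip: m_def)
  also have "\<bar>\<dots>\<bar> \<le> N.primitive (\<lambda>_. m x ^ Suc n / Suc n) x"
  proof (rule N.primitive_abs_le)
    fix t assume t: "0 \<le> t" "t \<le> x"
    then have le: "m t \<le> m x" unfolding m_def by (intro M.primitive_one_mono)
    \<comment> \<open>In the factorisation of \<open>m x ^ Suc n - m t ^ Suc n\<close> each of the \<open>Suc n\<close> summands in the factor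
      complementary to \<open>m x - m t\<close> is at least \<open>m t ^ n\<close>.\<close>
    have "real (Suc n) * (m t ^ n * (m x - m t)) = (m x - m t) * (\<Sum>i<Suc n. m t ^ n)"
      by simp
    also have "\<dots> \<le> (m x - m t) * (\<Sum>i<Suc n. m t ^ (n - i) * m x ^ i)"
    proof (intro mult_left_mono sum_mono)
      fix i assume "i \<in> {..<Suc n}"
      then have "m t ^ n = m t ^ (n - i) * m t ^ i" by (simp flip: power_add)
      also have "\<dots> \<le> m t ^ (n - i) * m x ^ i"
        by (intro mult_left_mono power_mono le m0 zero_le_power)
      finally show "m t ^ n \<le> m t ^ (n - i) * m x ^ i" .
    qed (use le in simp)
    also have "\<dots> = m x ^ Suc n - m t ^ Suc n"
      by (simp add: diff_power_eq_sum mult_ac del: power_Suc)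
    also have "\<dots> \<le> m x ^ Suc n"
      using m0[of t] by (simp del: power_Suc)
    finally have "m t ^ n * (m x - m t) \<le> m x ^ Suc n / real (Suc n)"
      by (simp add: pos_le_divide_eq mult.commute)
    then show "\<bar>m t ^ n * (m x - m t)\<bar> \<le> m x ^ Suc n / real (Suc n)"
      using m0[of t] le by (simp add: abs_mult)
  qed (intro admissible_intros adm)+
  also have "\<dots> = N.primitive (\<lambda>_. 1) x * m x ^ Suc n / Suc n"
    using N.primitive_linear[of "\<lambda>_. 1" "\<lambda>_. 0" "m x ^ Suc n / Suc n" 0 x] by simp
  finally show ?thesis by linarith
qed

text \<open>Each double primitive raises the power of \<open>m\<close> by one and gains a factor \<open>1 / Suc n\<close>; the other
  measure contributes at most the mass \<open>v\<close> of its segment up to \<open>X\<close>.\<close>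

lemma iterate_factorial_bound:
  assumes "admissible f"
  obtains K c where "\<And>n x. 0 \<le> x \<Longrightarrow> x \<le> X \<Longrightarrow> \<bar>(double_primitive ^^ n) f x\<bar> \<le> K * (c ^ n / fact n)"
proof -
  define m where "m = M.primitive (\<lambda>_. 1)"
  define v where "v = N.primitive (\<lambda>_. 1) X"
  have adm: "admissible m" unfolding m_def by (intro M.admissible_primitive admissible_const)
  have m0: "0 \<le> m y" for y unfolding m_def by (rule M.primitive_one_nonneg)
  have v0: "0 \<le> v" unfolding v_def by (rule N.primitive_one_nonneg)
  obtain K where K: "K \<ge> 0" "\<And>y. 0 \<le> y \<Longrightarrow> y \<le> X \<Longrightarrow> \<bar>f y\<bar> \<le> K"
    using admissibleD_bounded[OF assms] by metis
  have bound: "\<bar>(double_primitive ^^ n) f x\<bar> \<le> K * v ^ n / fact n * m x ^ n"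
    if "0 \<le> x" "x \<le> X" for n x
    using that
  proof (induction n arbitrary: x)
    case (Suc n)
    have "\<bar>(double_primitive ^^ Suc n) f x\<bar> \<le> double_primitive (\<lambda>y. K * v ^ n / fact n * m y ^ n) x"
      unfolding funpow.simps o_apply using Suc
      by (intro double_primitive_abs_le admissible_iterate assms admissible_mult[OF admissible_const]
          admissible_power adm) auto
    also have "\<dots> = K * v ^ n / fact n * double_primitive (\<lambda>y. m y ^ n) x"
      using double_primitive_linear[of "\<lambda>y. m y ^ n" "\<lambda>_. 0" "K * v ^ n / fact n" 0]
      by (simp add: admissible_power adm)
    also have "\<dots> \<le> K * v ^ n / fact n * (v * m x ^ Suc n / Suc n)"
    proof (rule mult_left_mono)
      have "double_primitive (\<lambda>y. m y ^ n) x \<le> N.primitive (\<lambda>_. 1) x * m x ^ Suc n / Suc n"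
        unfolding m_def by (rule double_primitive_power_le)
      also have "\<dots> \<le> v * m x ^ Suc n / Suc n"
        unfolding v_def
        by (intro divide_right_mono mult_right_mono N.primitive_one_mono Suc zero_le_power m0) auto
      finally show "double_primitive (\<lambda>y. m y ^ n) x \<le> v * m x ^ Suc n / Suc n" .
    qed (use K v0 in simp)
    finally show ?case by (simp add: field_simps)
  qed (use K in simp)
  show ?thesis
  proof (rule that)
    fix n :: nat and x :: real
    assume x: "0 \<le> x" "x \<le> X"
    have "\<bar>(double_primitive ^^ n) f x\<bar> \<le> K * v ^ n / fact n * m x ^ n"
      by (rule bound[OF x])
    also have "\<dots> \<le> K * v ^ n / fact n * m X ^ n"
      using x K v0 m0 by (intro mult_left_mono power_mono) (auto simp: m_def intro: M.primitive_one_mono)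
    finally show "\<bar>(double_primitive ^^ n) f x\<bar> \<le> K * ((v * m X) ^ n / fact n)"
      by (simp add: power_mult_distrib)
  qed
qed

lemma summable_iterates:
  assumes "admissible f" "0 \<le> x"
  shows "summable (\<lambda>n. l ^ n * (double_primitive ^^ n) f x)"
proof -
  obtain K c where Kc: "\<And>n y. 0 \<le> y \<Longrightarrow> y \<le> x \<Longrightarrow> \<bar>(double_primitive ^^ n) f y\<bar> \<le> K * (c ^ n / fact n)"
    using iterate_factorial_bound[OF assms(1)] by metis
  have "summable (\<lambda>n. K * ((\<bar>l\<bar> * c) ^ n /\<^sub>R fact n))"
    by (intro summable_mult summable_exp_generic)
  then show ?thesis
  proof (rule summable_comparison_test')
    fix n
    have "\<bar>l\<bar> ^ n * \<bar>(double_primitive ^^ n) f x\<bar> \<le> \<bar>l\<bar> ^ n * (K * (c ^ n / fact n))"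
      using assms(2) by (intro mult_left_mono Kc) auto
    then show "norm (l ^ n * (double_primitive ^^ n) f x) \<le> K * ((\<bar>l\<bar> * c) ^ n /\<^sub>R fact n)"
      by (simp add: abs_mult power_abs power_mult_distrib field_simps)
  qed
qed

text \<open>Repeated substitution of the equation into itself leaves the remainder
  \<open>l ^ n * (double_primitive ^^ n) f x\<close>, which tends to zero as the general term of a convergent series.
  The equation is needed only on \<open>{0..x}\<close> because the primitives at a point look only to the left.\<close>

lemma neumann_series:
  assumes f: "admissible f" and q: "admissible q"
    and eq: "\<And>y. 0 \<le> y \<Longrightarrow> y \<le> x \<Longrightarrow> f y = q y + l * double_primitive f y"
    and x: "0 \<le> x"
  shows "(\<lambda>n. l ^ n * (double_primitive ^^ n) q x) sums f x"
proof -
  have partial: "f x = (\<Sum>k<n. l ^ k * (double_primitive ^^ k) q x) + l ^ n * (double_primitive ^^ n) f x"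
    for n
  proof (induction n)
    case (Suc n)
    have "(double_primitive ^^ n) f x = (double_primitive ^^ n) (\<lambda>y. 1 * q y + l * double_primitive f y) x"
      using eq by (intro iterate_cong x) auto
    also have "\<dots> = (double_primitive ^^ n) q x + l * (double_primitive ^^ Suc n) f x"
      by (simp only: iterate_linear[OF q admissible_double_primitive[OF f]] funpow_Suc_right) simp
    finally show ?case using Suc by (simp add: algebra_simps)
  qed simp
  have "(\<lambda>n. f x - l ^ n * (double_primitive ^^ n) f x) \<longlonglongrightarrow> f x - 0"
    by (intro tendsto_diff tendsto_const summable_LIMSEQ_zero summable_iterates f x)
  moreover have "(\<lambda>n. \<Sum>k<n. l ^ k * (double_primitive ^^ k) q x) =
      (\<lambda>n. f x - l ^ n * (double_primitive ^^ n) f x)"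
    using partial by (simp add: fun_eq_iff eq_diff_eq)
  ultimately show ?thesis
    unfolding sums_def by simp
qed

section \<open>The recursion from the largest variable downwards\<close>

text \<open>The value \<open>tail n x s\<close> is the measure of the set of chains of \<open>n\<close> interlaced variables lying between \<open>s\<close> and
  \<open>x\<close>, the largest of them being distributed according to \<open>M\<close>. For \<open>n \<ge> 1\<close> and \<open>0 \<le> s \<le> x\<close> it is the difference
  \<open>F\<^sub>n(x,x) - F\<^sub>n(x,s)\<close> or \<open>G\<^sub>n(x,x) - G\<^sub>n(x,s)\<close>, depending on which measure is \<open>M\<close>.\<close>

primrec tail :: "nat \<Rightarrow> real \<Rightarrow> real \<Rightarrow> real" where
  "tail 0 x s = 1"
| "tail (Suc n) x s =
     (if even n then M.primitive (tail n x) x - M.primitive (tail n x) s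
      else N.primitive (tail n x) x - N.primitive (tail n x) s)"

lemma admissible_tail: "admissible (tail n x)"
proof (induction n)
  case 0
  have "tail 0 x = (\<lambda>_. 1)" by auto
  then show ?case by simp
next
  case (Suc n)
  then show ?case
    by (cases "even n")
      (auto intro!: admissible_diff M.admissible_primitive N.admissible_primitive)
qed

text \<open>Each use of adjointness removes the smallest variable of the chain from \<open>tail\<close> and turns it into
  a primitive applied to \<open>p\<close>. The weight \<open>p\<close> has to be arbitrary for this to be an induction.\<close>

lemma primitive_tail_even:
  assumes "admissible p"
  shows "M.primitive (\<lambda>s. p s * tail (2 * n) x s) x = (double_primitive ^^ n) (M.primitive p) x"
  using assms
proof (induction n arbitrary: p)
  case (Suc n)
  note adm = M.admissible_primitive[OF Suc.prems]
  have "M.primitive (\<lambda>s. p s * tail (2 * Suc n) x s) x =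
      N.primitive (\<lambda>t. M.primitive p t * tail (Suc (2 * n)) x t) x"
    using primitive_adjoint_swap[OF Suc.prems admissible_tail[of "Suc (2 * n)" x], of x] by simp
  also have "\<dots> = M.primitive (\<lambda>s. N.primitive (M.primitive p) s * tail (2 * n) x s) x"
    using primitive_adjoint[OF adm admissible_tail[of "2 * n" x], of x] by simp
  also have "\<dots> = (double_primitive ^^ Suc n) (M.primitive p) x"
    using Suc.IH[OF N.admissible_primitive[OF adm]]
    by (simp add: funpow_swap1 flip: double_primitive_def)
  finally show ?case .
qed simp

lemma primitive_tail_odd:
  assumes "admissible p"
  shows "N.primitive (\<lambda>s. p s * tail (Suc (2 * n)) x s) x = (double_primitive ^^ Suc n) p x"
  using primitive_adjoint[OF assms admissible_tail[of "2 * n" x], of x]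
    primitive_tail_even[OF N.admissible_primitive[OF assms], of n x]
  by (simp add: funpow_swap1 flip: double_primitive_def)

end

section \<open>The measures of a cadlag and a caglad function\<close>

lemma initial_segments_interval_measure:
  assumes "mono W" "cadlag W"
  shows "initial_segments (interval_measure W) (\<lambda>x. {0<..x})"
proof -
  have cont: "\<And>x. continuous (at_right x) W" and mono: "\<And>x y. x \<le> y \<Longrightarrow> W x \<le> W y"
    using assms by (auto simp: cadlag_def monoD)
  interpret sigma_finite_measure "interval_measure W"
    by (rule sigma_finite_interval_measure[OF mono cont])
  have "{(x, y). y \<in> {0<..x}} = {z \<in> space (borel \<Otimes>\<^sub>M borel). 0 < snd z \<and> snd z \<le> (fst z :: real)}"
    by (auto simp: space_pair_measure)
  also have "\<dots> \<in> sets (borel \<Otimes>\<^sub>M borel)"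
    by measurable
  finally have pairs: "{(x, y). y \<in> {0<..x}} \<in> sets (borel \<Otimes>\<^sub>M (borel :: real measure))" .
  show ?thesis
  proof unfold_locales
    fix x :: real
    show "emeasure (interval_measure W) {0<..x} < \<infinity>"
      using emeasure_interval_measure_Ioc[of 0 x W] mono cont by (cases "0 \<le> x") auto
  qed (use pairs in auto)
qed

lemma initial_segments_left_interval_measure:
  assumes "mono V" "caglad V"
  shows "initial_segments (left_interval_measure V) (\<lambda>x. {0..<x})"
proof -
  have sets: "sets (left_interval_measure V) = sets borel"
    by (simp add: left_interval_measure_def)
  have finite: "emeasure (left_interval_measure V) {x..<y} < \<infinity>" for x y
    using emeasure_left_interval_measure[of x y V] assms by (cases "x \<le> y") auto
  have "{(x, y). y \<in> {0..<x}} = {z \<in> space (borel \<Otimes>\<^sub>M borel). 0 \<le> snd z \<and> snd z < (fst z :: real)}"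
    by (auto simp: space_pair_measure)
  also have "\<dots> \<in> sets (borel \<Otimes>\<^sub>M borel)"
    by measurable
  finally have pairs: "{(x, y). y \<in> {0..<x}} \<in> sets (borel \<Otimes>\<^sub>M (borel :: real measure))" .
  have UN: "(\<Union>n. {- real n..<real n}) = UNIV"
  proof (intro equalityI subsetI)
    fix x :: real
    obtain n where "\<bar>x\<bar> < real n" using reals_Archimedean2 by blast
    then show "x \<in> (\<Union>n. {- real n..<real n})" by (intro UN_I[of n]) auto
  qed auto
  show ?thesis
  proof unfold_locales
    show "\<exists>A. countable A \<and> A \<subseteq> sets (left_interval_measure V) \<and>
        \<Union> A = space (left_interval_measure V) \<and> (\<forall>a\<in>A. emeasure (left_interval_measure V) a \<noteq> \<infinity>)"
      using finite UN sets_eq_imp_space_eq[OF sets]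
      by (intro exI[of _ "range (\<lambda>n. {- real n..<real n})"]) (auto simp: sets less_top)
  qed (use sets pairs finite in auto)
qed

locale cadlag_caglad_pair =
  fixes W V :: "real \<Rightarrow> real"
  assumes mono_W: "mono W" and mono_V: "mono V"
    and cadlag_W: "cadlag W" and caglad_V: "caglad V"
    and W_0: "W 0 = 0" and V_0: "V 0 = 0"
begin

sublocale WV: interlaced_measures "interval_measure W" "left_interval_measure V" "\<lambda>x. {0<..x}" "\<lambda>x. {0..<x}"
proof -
  interpret M: initial_segments "interval_measure W" "\<lambda>x. {0<..x}"
    by (rule initial_segments_interval_measure[OF mono_W cadlag_W])
  interpret N: initial_segments "left_interval_measure V" "\<lambda>x. {0..<x}"
    by (rule initial_segments_left_interval_measure[OF mono_V caglad_V])
  show "interlaced_measures (interval_measure W) (left_interval_measure V) (\<lambda>x. {0<..x}) (\<lambda>x. {0..<x})"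
    by unfold_locales auto
qed

text \<open>As the locale is symmetric, what is known for \<open>I J\<close> holds for \<open>J I\<close> as well; the latter produces
  the functions whose mathematical suffix is \<open>V,W\<close>.\<close>

sublocale VW: interlaced_measures "left_interval_measure V" "interval_measure W" "\<lambda>x. {0..<x}" "\<lambda>x. {0<..x}"
  by (rule WV.interlaced_measures_swap)

lemma primitive_one_W:
  assumes "0 \<le> x"
  shows "WV.M.primitive (\<lambda>_. 1) x = W x"
proof -
  have "measure (interval_measure W) {0<..x} = W x - W 0"
    by (rule measure_interval_measure_Ioc)
      (use assms mono_W cadlag_W in \<open>auto simp: cadlag_def monoD\<close>)
  then show ?thesis
    by (simp add: WV.M.primitive_def set_lebesgue_integral_def W_0)
qed

lemma primitive_one_V:
  assumes "0 \<le> x"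
  shows "WV.N.primitive (\<lambda>_. 1) x = V x"
proof -
  have "measure (left_interval_measure V) {0..<x} = V x - V 0"
    using emeasure_left_interval_measure[OF assms mono_V caglad_V] monoD[OF mono_V assms]
    by (simp add: measure_def)
  then show ?thesis
    by (simp add: WV.N.primitive_def set_lebesgue_integral_def V_0)
qed

section \<open>The generalized trigonometric functions as series of iterates\<close>

lemma F_WV_tail:
  assumes "0 \<le> s" "s \<le> x"
  shows "F_WV W V (Suc n) x s =
    (if even n then WV.M.primitive (WV.tail n x) s else WV.N.primitive (WV.tail n x) s)"
  using assms
proof (induction n arbitrary: s)
  case 0
  have "WV.tail 0 x = (\<lambda>_. 1)" by auto
  then show ?case using primitive_one_W[OF 0(1)] by simp
next
  case (Suc n)
  have diff: "F_WV W V (Suc n) x x - F_WV W V (Suc n) x t = WV.tail (Suc n) x t" if "0 \<le> t" "t \<le> s" for t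
    using Suc that by simp
  have "WV.N.primitive (\<lambda>t. F_WV W V (Suc n) x x - F_WV W V (Suc n) x t) s = WV.N.primitive (WV.tail (Suc n) x) s"
    by (rule WV.N.primitive_cong[OF diff])
  moreover have "WV.M.primitive (\<lambda>t. F_WV W V (Suc n) x x - F_WV W V (Suc n) x t) s = WV.M.primitive (WV.tail (Suc n) x) s"
    by (rule WV.M.primitive_cong[OF diff])
  ultimately show ?case
    by (simp add: WV.N.primitive_def WV.M.primitive_def del: WV.tail.simps)
qed

lemma G_WV_tail:
  assumes "0 \<le> s" "s \<le> x"
  shows "G_WV W V (Suc n) x s =
    (if even n then WV.N.primitive (VW.tail n x) s else WV.M.primitive (VW.tail n x) s)"
  using assms
proof (induction n arbitrary: s)
  case 0
  have "VW.tail 0 x = (\<lambda>_. 1)" by auto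
  then show ?case using primitive_one_V[OF 0(1)] by simp
next
  case (Suc n)
  have diff: "G_WV W V (Suc n) x x - G_WV W V (Suc n) x t = VW.tail (Suc n) x t" if "0 \<le> t" "t \<le> s" for t
    using Suc that by simp
  have "WV.N.primitive (\<lambda>t. G_WV W V (Suc n) x x - G_WV W V (Suc n) x t) s = WV.N.primitive (VW.tail (Suc n) x) s"
    by (rule WV.N.primitive_cong[OF diff])
  moreover have "WV.M.primitive (\<lambda>t. G_WV W V (Suc n) x x - G_WV W V (Suc n) x t) s = WV.M.primitive (VW.tail (Suc n) x) s"
    by (rule WV.M.primitive_cong[OF diff])
  ultimately show ?case
    by (simp add: WV.N.primitive_def WV.M.primitive_def del: VW.tail.simps)
qed

lemma F_WV_odd:
  assumes "0 \<le> x"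
  shows "F_WV W V (2 * n + 1) x x = (WV.double_primitive ^^ n) (WV.M.primitive (\<lambda>_. 1)) x"
  using F_WV_tail[OF assms order_refl, of "2 * n"] WV.primitive_tail_even[of "\<lambda>_. 1" n x] by simp

lemma F_WV_even:
  assumes "0 \<le> x"
  shows "F_WV W V (2 * n) x x = (WV.double_primitive ^^ n) (\<lambda>_. 1) x"
proof (cases n)
  case (Suc m)
  then show ?thesis
    using F_WV_tail[OF assms order_refl, of "Suc (2 * m)"] WV.primitive_tail_odd[of "\<lambda>_. 1" m x]
    by (simp del: WV.tail.simps F_WV.simps)
qed simp

lemma G_WV_odd:
  assumes "0 \<le> x"
  shows "G_WV W V (2 * n + 1) x x = (VW.double_primitive ^^ n) (WV.N.primitive (\<lambda>_. 1)) x"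
  using G_WV_tail[OF assms order_refl, of "2 * n"] VW.primitive_tail_even[of "\<lambda>_. 1" n x] by simp

lemma G_WV_even:
  assumes "0 \<le> x"
  shows "G_WV W V (2 * n) x x = (VW.double_primitive ^^ n) (\<lambda>_. 1) x"
proof (cases n)
  case (Suc m)
  then show ?thesis
    using G_WV_tail[OF assms order_refl, of "Suc (2 * m)"] VW.primitive_tail_odd[of "\<lambda>_. 1" m x]
    by (simp del: VW.tail.simps G_WV.simps)
qed simp

lemma C_WV_sums:
  assumes "0 \<le> l" "0 \<le> x"
  shows "(\<lambda>n. (- l) ^ n * (WV.double_primitive ^^ n) (\<lambda>_. 1) x) sums C_WV W V (sqrt l) x"
proof -
  have "C_WV W V (sqrt l) x = (\<Sum>n. (- l) ^ n * (WV.double_primitive ^^ n) (\<lambda>_. 1) x)"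
    unfolding C_WV_def
    by (simp only: F_WV_even[OF assms(2)]) (simp add: power_mult assms(1) flip: power_minus)
  then show ?thesis
    using summable_sums[OF WV.summable_iterates[OF admissible_const assms(2), of "- l" 1]] by simp
qed

lemma C_VW_sums:
  assumes "0 \<le> l" "0 \<le> x"
  shows "(\<lambda>n. (- l) ^ n * (VW.double_primitive ^^ n) (\<lambda>_. 1) x) sums C_VW W V (sqrt l) x"
proof -
  have "C_VW W V (sqrt l) x = (\<Sum>n. (- l) ^ n * (VW.double_primitive ^^ n) (\<lambda>_. 1) x)"
    unfolding C_VW_def
    by (simp only: G_WV_even[OF assms(2)]) (simp add: power_mult assms(1) flip: power_minus)
  then show ?thesis
    using summable_sums[OF VW.summable_iterates[OF admissible_const assms(2), of "- l" 1]] by simp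
qed

lemma S_WV_sums:
  assumes "0 < l" "0 \<le> x"
  shows "(\<lambda>n. (- l) ^ n * (WV.double_primitive ^^ n) (WV.M.primitive (\<lambda>_. 1)) x) sums (S_WV W V (sqrt l) x / sqrt l)"
proof -
  let ?t = "\<lambda>n. (- l) ^ n * (WV.double_primitive ^^ n) (WV.M.primitive (\<lambda>_. 1)) x"
  have sum: "summable ?t"
    by (intro WV.summable_iterates WV.M.admissible_primitive assms admissible_const)
  have pow: "sqrt l ^ (2 * n + 1) = l ^ n * sqrt l" for n
    using assms(1) by (simp only: power_add power_mult real_sqrt_pow2 less_imp_le power_one_right)
  have "S_WV W V (sqrt l) x = (\<Sum>n. sqrt l * ?t n)"
    unfolding S_WV_def F_WV_odd[OF assms(2)]
    by (intro suminf_cong) (simp only: pow, simp add: power_minus[of l] mult_ac)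
  also have "\<dots> = sqrt l * suminf ?t"
    by (rule suminf_mult[OF sum])
  finally show ?thesis
    using summable_sums[OF sum] assms(1) by simp
qed

lemma S_VW_sums:
  assumes "0 < l" "0 \<le> x"
  shows "(\<lambda>n. (- l) ^ n * (VW.double_primitive ^^ n) (WV.N.primitive (\<lambda>_. 1)) x) sums (S_VW W V (sqrt l) x / sqrt l)"
proof -
  let ?t = "\<lambda>n. (- l) ^ n * (VW.double_primitive ^^ n) (WV.N.primitive (\<lambda>_. 1)) x"
  have sum: "summable ?t"
    by (intro VW.summable_iterates WV.N.admissible_primitive assms admissible_const)
  have pow: "sqrt l ^ (2 * n + 1) = l ^ n * sqrt l" for n
    using assms(1) by (simp only: power_add power_mult real_sqrt_pow2 less_imp_le power_one_right)
  have "S_VW W V (sqrt l) x = (\<Sum>n. sqrt l * ?t n)"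
    unfolding S_VW_def G_WV_odd[OF assms(2)]
    by (intro suminf_cong) (simp only: pow, simp add: power_minus[of l] mult_ac)
  also have "\<dots> = sqrt l * suminf ?t"
    by (rule suminf_mult[OF sum])
  finally show ?thesis
    using summable_sums[OF sum] assms(1) by simp
qed

section \<open>Volterra equations and eigenfunctions\<close>

text \<open>The second claim is the Neumann series of the dual equation satisfied by \<open>J w\<close>. Its
  inhomogeneity is \<open>J (a + b W) = a V + b (J I) 1\<close>, so the coefficient of \<open>b\<close> is the series of
  \<open>C\<^bsub>V,W\<^esub>\<close> shifted by one index, which accounts for the subtracted \<open>1\<close> and the factor \<open>- 1 / l\<close>.\<close>

lemma volterra_solution:
  assumes w: "admissible w" and l: "0 < l" and x: "0 \<le> x"
    and eq: "\<And>y. 0 \<le> y \<Longrightarrow> y \<le> x \<Longrightarrow>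
      w y = a + b * WV.M.primitive (\<lambda>_. 1) y - l * WV.double_primitive w y"
  shows "w x = a * C_WV W V (sqrt l) x + b / sqrt l * S_WV W V (sqrt l) x"
    and "WV.N.primitive w x =
      a / sqrt l * S_VW W V (sqrt l) x - b / l * (C_VW W V (sqrt l) x - 1)"
proof -
  define m where "m = WV.M.primitive (\<lambda>_. 1)"
  define v where "v = WV.N.primitive (\<lambda>_. 1)"
  define q where "q = (\<lambda>y. a * 1 + b * m y)"
  have m: "admissible m" and v: "admissible v"
    unfolding m_def v_def by (intro WV.M.admissible_primitive WV.N.admissible_primitive admissible_const)+
  have q: "admissible q"
    unfolding q_def by (intro admissible_intros m)
  have eq': "w y = q y + - l * WV.double_primitive w y" if "0 \<le> y" "y \<le> x" for y
    using eq[OF that] by (simp add: q_def m_def)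
  have "(\<lambda>n. (- l) ^ n * (WV.double_primitive ^^ n) q x) sums w x"
    by (rule WV.neumann_series[OF w q eq' x])
  moreover have "(\<lambda>n. a * ((- l) ^ n * (WV.double_primitive ^^ n) (\<lambda>_. 1) x)
        + b * ((- l) ^ n * (WV.double_primitive ^^ n) m x))
      sums (a * C_WV W V (sqrt l) x + b * (S_WV W V (sqrt l) x / sqrt l))"
    unfolding m_def using l x by (intro sums_add sums_mult C_WV_sums S_WV_sums) auto
  ultimately show "w x = a * C_WV W V (sqrt l) x + b / sqrt l * S_WV W V (sqrt l) x"
    unfolding q_def WV.iterate_linear[OF admissible_const m]
    by (intro sums_unique2) (simp_all add: algebra_simps)

  have Vq: "WV.N.primitive q = (\<lambda>y. a * v y + b * VW.double_primitive (\<lambda>_. 1) y)"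
    unfolding q_def v_def VW.double_primitive_def m_def[symmetric]
    by (intro ext WV.N.primitive_linear admissible_const m)
  have Veq: "WV.N.primitive w y = WV.N.primitive q y + - l * VW.double_primitive (WV.N.primitive w) y"
    if "0 \<le> y" "y \<le> x" for y
  proof -
    have "WV.N.primitive w y = WV.N.primitive (\<lambda>t. 1 * q t + - l * WV.double_primitive w t) y"
      by (rule WV.N.primitive_cong) (use eq' that in auto)
    also have "\<dots> = 1 * WV.N.primitive q y + - l * WV.N.primitive (WV.double_primitive w) y"
      by (rule WV.N.primitive_linear[OF q WV.admissible_double_primitive[OF w]])
    finally show ?thesis
      by (simp add: WV.double_primitive_def VW.double_primitive_def)
  qed
  have "(\<lambda>n. (- l) ^ n * (VW.double_primitive ^^ n) (WV.N.primitive q) x) sums WV.N.primitive w x"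
    by (rule VW.neumann_series[OF WV.N.admissible_primitive[OF w] WV.N.admissible_primitive[OF q] Veq x])
  then have "(\<lambda>n. a * ((- l) ^ n * (VW.double_primitive ^^ n) v x)
        + b * ((- l) ^ n * (VW.double_primitive ^^ Suc n) (\<lambda>_. 1) x)) sums WV.N.primitive w x"
    unfolding Vq VW.iterate_linear[OF v VW.admissible_double_primitive[OF admissible_const]]
    by (simp add: algebra_simps funpow_swap1)
  moreover have "(\<lambda>n. (- l) ^ n * (VW.double_primitive ^^ Suc n) (\<lambda>_. 1) x) sums
      ((C_VW W V (sqrt l) x - 1) / - l)"
  proof -
    have "(\<lambda>n. (- l) ^ Suc n * (VW.double_primitive ^^ Suc n) (\<lambda>_. 1) x) sums (C_VW W V (sqrt l) x - 1)"
      using C_VW_sums[of l x] l x by (subst sums_Suc_iff) simp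
    from sums_divide[OF this, of "- l"] show ?thesis
      using l by simp
  qed
  then have "(\<lambda>n. a * ((- l) ^ n * (VW.double_primitive ^^ n) v x)
        + b * ((- l) ^ n * (VW.double_primitive ^^ Suc n) (\<lambda>_. 1) x))
      sums (a * (S_VW W V (sqrt l) x / sqrt l) + b * ((C_VW W V (sqrt l) x - 1) / - l))"
    unfolding v_def by (intro sums_add sums_mult S_VW_sums l x)
  ultimately show "WV.N.primitive w x =
      a / sqrt l * S_VW W V (sqrt l) x - b / l * (C_VW W V (sqrt l) x - 1)"
    by (auto dest: sums_unique2)
qed

lemma space_torus_measure: "space (torus_measure V) = {0..<1}"
  by (simp add: torus_measure_def space_restrict_space)

lemma L2_integrable:
  assumes "g \<in> L2 V"
  shows "integrable (torus_measure V) g"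
proof -
  have meas: "g \<in> borel_measurable (torus_measure V)"
    and sq: "integrable (torus_measure V) (\<lambda>x. (g x)\<^sup>2)"
    using assms by (auto simp: L2_def)
  have "emeasure (torus_measure V) (space (torus_measure V)) \<noteq> \<infinity>"
    using WV.N.segment_finite[of 1]
    by (simp add: space_torus_measure) (simp add: torus_measure_def emeasure_restrict_space)
  then interpret finite_measure "torus_measure V" by (rule finite_measureI)
  have "integrable (torus_measure V) (\<lambda>x. 1 + (g x)\<^sup>2)"
    by (intro Bochner_Integration.integrable_add sq) simp
  then show ?thesis
  proof (rule Bochner_Integration.integrable_bound[OF _ meas], intro AE_I2)
    fix x
    have "0 \<le> (\<bar>g x\<bar> - 1)\<^sup>2 + \<bar>g x\<bar>\<^sup>2 + 1" by simp
    then show "norm (g x) \<le> norm (1 + (g x)\<^sup>2)" by (simp add: power2_eq_square algebra_simps)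
  qed
qed

text \<open>The eigenfunction \<open>u\<close> is determined only almost everywhere on \<open>[0,1)\<close>, whereas the boundary
  conditions concern the point \<open>1\<close>. Therefore \<open>u\<close> is replaced by the function \<open>w\<close> which its
  representation defines everywhere: \<open>w\<close> is locally bounded, and it satisfies the Volterra
  equation at every point of \<open>[0,1]\<close>.\<close>

lemma eigenfunction_trigonometric:
  assumes l: "0 < l" and eigen: "neg_laplacian_eigenpair W V l u"
  shows "\<exists>a b. (AE x in torus_measure V.
       u x = a * C_WV W V (sqrt l) x + b / sqrt l * S_WV W V (sqrt l) x) \<and>
    (a, b) \<noteq> (0, 0) \<and>
    a * (C_WV W V (sqrt l) 1 - 1) + b / sqrt l * S_WV W V (sqrt l) 1 = 0 \<and>
    a / sqrt l * S_VW W V (sqrt l) 1 - b / l * (C_VW W V (sqrt l) 1 - 1) = 0"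
proof -
  let ?I = "WV.M.primitive" and ?J = "WV.N.primitive"
  define g where "g = laplacian W V u"
  have "\<exists>g. laplacian_witness W V u g"
    using eigen by (auto simp: neg_laplacian_eigenpair_def laplacian_domain_def)
  then have "laplacian_witness W V u g"
    unfolding g_def laplacian_def by (rule someI_ex)
  then obtain a b where g: "g \<in> L2_zero_mean V"
    and u: "AE x in torus_measure V. u x = a + b * W x + double_integral W V g x"
    and end1: "b * W 1 + double_integral W V g 1 = 0"
    unfolding laplacian_witness_def by blast
  have g_eigen: "AE x in torus_measure V. - g x = l * u x"
    and nonzero: "\<not> (AE x in torus_measure V. u x = 0)"
    using eigen by (auto simp: neg_laplacian_eigenpair_def g_def)
  have g_int: "integrable (torus_measure V) g" and g_mean: "(LINT x|torus_measure V. g x) = 0"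
    using g L2_integrable by (auto simp: L2_zero_mean_def)

  \<comment> \<open>The function \<open>g\<close> is measurable only on the torus; outside \<open>[0,1)\<close> it may be arbitrary.\<close>
  define h where "h = (\<lambda>s. indicator {0..<1} s * g s)"
  have h_int: "integrable (left_interval_measure V) h"
    using g_int unfolding torus_measure_def h_def by (subst (asm) integrable_restrict_space) auto
  have h: "h \<in> borel_measurable borel"
    using borel_measurable_integrable[OF h_int] by (simp cong: measurable_cong_sets)
  have h_set_int: "set_integrable (left_interval_measure V) {0..<x} h" for x
    unfolding set_integrable_def using h_int by (intro integrable_mult_indicator) auto
  have Jh_adm: "admissible (?J h)"
    by (rule WV.N.admissible_primitive_integrable[OF h h_set_int])
  have D_eq: "double_integral W V g x = ?I (?J h) x" if "x \<le> 1" for x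
  proof -
    have "double_integral W V g x = ?I (?J g) x"
      by (simp add: double_integral_def WV.M.primitive_def WV.N.primitive_def)
    also have "\<dots> = ?I (?J h) x"
    proof (rule WV.M.primitive_cong)
      fix y assume "y \<le> x"
      then show "?J g y = ?J h y"
        unfolding WV.N.primitive_def using that
        by (intro set_lebesgue_integral_cong) (auto simp: h_def)
    qed
    finally show ?thesis .
  qed

  define w where "w = (\<lambda>x. a + b * ?I (\<lambda>_. 1) x + ?I (?J h) x)"
  have w: "admissible w"
    unfolding w_def by (intro admissible_intros WV.M.admissible_primitive Jh_adm)
  have uw: "AE x in torus_measure V. u x = w x"
    using u
  proof (rule AE_mp, intro AE_I2 impI)
    fix x assume "x \<in> space (torus_measure V)" "u x = a + b * W x + double_integral W V g x"
    then show "u x = w x"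
      by (simp add: space_torus_measure w_def D_eq primitive_one_W)
  qed
  have "AE x in torus_measure V. g x = - l * w x"
    using uw g_eigen by eventually_elim auto
  then have hw: "AE x in left_interval_measure V. x \<in> {0..<1} \<longrightarrow> g x = - l * w x"
    unfolding torus_measure_def by (subst (asm) AE_restrict_space_iff) auto
  have Jh: "?J h y = - l * ?J w y" if "y \<le> 1" for y
  proof -
    have "?J h y = ?J (\<lambda>s. - l * w s + 0 * w s) y"
      unfolding WV.N.primitive_def set_lebesgue_integral_def
      using h admissibleD_measurable[OF w] hw that
      by (intro integral_cong_AE) (auto simp: h_def indicator_def elim!: eventually_mono)
    then show ?thesis
      by (subst (asm) WV.N.primitive_linear[OF w w]) simp
  qed
  have volterra: "w y = a + b * ?I (\<lambda>_. 1) y - l * WV.double_primitive w y" if "y \<le> 1" for y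
  proof -
    have "?I (?J h) y = ?I (\<lambda>t. - l * ?J w t + 0 * ?J w t) y"
      by (rule WV.M.primitive_cong) (use Jh that in auto)
    then show ?thesis
      by (subst (asm) WV.M.primitive_linear[OF WV.N.admissible_primitive[OF w] WV.N.admissible_primitive[OF w]])
        (simp add: w_def WV.double_primitive_def)
  qed
  have series: "w x = a * C_WV W V (sqrt l) x + b / sqrt l * S_WV W V (sqrt l) x"
    if "0 \<le> x" "x \<le> 1" for x
    using that by (intro volterra_solution w l volterra) auto

  have "w 1 = a"
    using end1 by (simp add: w_def D_eq primitive_one_W)
  then have sys1: "a * (C_WV W V (sqrt l) 1 - 1) + b / sqrt l * S_WV W V (sqrt l) 1 = 0"
    using series[of 1] by (simp add: algebra_simps)
  have "?J h 1 = (LINT x|torus_measure V. g x)"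
    unfolding torus_measure_def
    by (subst integral_restrict_space) (auto simp: WV.N.primitive_def set_lebesgue_integral_def h_def indicator_def intro!: Bochner_Integration.integral_cong)
  then have "?J w 1 = 0"
    using g_mean Jh[of 1] l by simp
  then have sys2: "a / sqrt l * S_VW W V (sqrt l) 1 - b / l * (C_VW W V (sqrt l) 1 - 1) = 0"
    using volterra_solution(2)[OF w l zero_le_one volterra] by simp
  have u_series: "AE x in torus_measure V. u x = a * C_WV W V (sqrt l) x + b / sqrt l * S_WV W V (sqrt l) x"
    using uw
  proof (rule AE_mp, intro AE_I2 impI)
    fix x assume "x \<in> space (torus_measure V)" "u x = w x"
    then show "u x = a * C_WV W V (sqrt l) x + b / sqrt l * S_WV W V (sqrt l) x"
      using series[of x] by (simp add: space_torus_measure)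
  qed
  moreover have "(a, b) \<noteq> (0, 0)"
    using u_series nonzero by auto
  ultimately show ?thesis
    using sys1 sys2 by blast
qed

end

theorem proposition13:
  fixes W V :: "real \<Rightarrow> real"
    and lam :: "nat \<Rightarrow> real"
    and nu :: "nat \<Rightarrow> real \<Rightarrow> real"
  assumes "strict_mono W" and "strict_mono V"
    and "cadlag W" and "caglad V"
    and "\<And>x. W (x + 1) - W x = W 1 - W 0"
    and "\<And>x. V (x + 1) - V x = V 1 - V 0"
    and "isCont W 0" and "isCont V 0"
    and "W 0 = 0" and "V 0 = 0"
    and "\<And>i. i > 0 \<Longrightarrow> lam i > 0"
    and "\<And>i. i > 0 \<Longrightarrow> neg_laplacian_eigenpair W V (lam i) (nu i)"
  shows "\<exists>a b :: nat \<Rightarrow> real. \<forall>i>0.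
    (AE x in torus_measure V.
       nu i x = a i * C_WV W V (sqrt (lam i)) x + b i / sqrt (lam i) * S_WV W V (sqrt (lam i)) x) \<and>
    (a i, b i) \<noteq> (0, 0) \<and>
    a i * (C_WV W V (sqrt (lam i)) 1 - 1) + b i / sqrt (lam i) * S_WV W V (sqrt (lam i)) 1 = 0 \<and>
    a i / sqrt (lam i) * S_VW W V (sqrt (lam i)) 1 - b i / lam i * (C_VW W V (sqrt (lam i)) 1 - 1) = 0"
proof -
  interpret cadlag_caglad_pair W V
    by unfold_locales (use assms in \<open>auto intro: strict_mono_mono\<close>)
  have "\<exists>p. (AE x in torus_measure V.
       nu i x = fst p * C_WV W V (sqrt (lam i)) x + snd p / sqrt (lam i) * S_WV W V (sqrt (lam i)) x) \<and>
    (fst p, snd p) \<noteq> (0, 0) \<and>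
    fst p * (C_WV W V (sqrt (lam i)) 1 - 1) + snd p / sqrt (lam i) * S_WV W V (sqrt (lam i)) 1 = 0 \<and>
    fst p / sqrt (lam i) * S_VW W V (sqrt (lam i)) 1 - snd p / lam i * (C_VW W V (sqrt (lam i)) 1 - 1) = 0"
    (is "\<exists>p. ?solves i p") if "i > 0" for i
    using eigenfunction_trigonometric[OF assms(11,12)[OF that]] by (simp only: split_paired_Ex fst_conv snd_conv)
  then have "\<forall>i. \<exists>p. i > 0 \<longrightarrow> ?solves i p"
    by blast
  then obtain c where "\<forall>i. i > 0 \<longrightarrow> ?solves i (c i)"
    by (rule choice[THEN exE])
  then show ?thesis
    by (intro exI[of _ "\<lambda>i. fst (c i)"] exI[of _ "\<lambda>i. snd (c i)"])
qed

end
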